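(* Let $n\ge1$ and let $X^1,X^2,Y^1,Y^2$ be diagonal $n\times n$ complex matrices. For complex parameters $\beta_1,\beta_2$ define the map $R(\beta_1,\beta_2):\big((X^1,X^2),(Y^1,Y^2)\big)\mapsto\big((P^1,P^2),(Q^1,Q^2)\big)$ by $$(P^1,P^2)=(Y^1S^{-1},\;Y^2S),\qquad (Q^1,Q^2)=\big(X^1S,\;X^2+Y^2(I-S)\big),\qquad S=I+\frac{(\beta_1-\beta_2)(X^1)^{-1}}{1-\operatorname{tr}\big(Y^2(X^1)^{-1}\big)}.$$ Then: (a) whenever the vectors $\boldsymbol u,\boldsymbol v,\boldsymbol u_{(1)},\boldsymbol u_{(2)},\boldsymbol v_{(2)},\boldsymbol u_{(1,2)},\boldsymbol v_{(1,2)}\in\mathbb{C}^n$ satisfy $$\boldsymbol u_{(1,2)}=\boldsymbol u+\frac{\beta_1-\beta_2}{1-\boldsymbol u_{(1)}\cdot\boldsymbol v_{(2)}}\boldsymbol u_{(1)},\qquad \boldsymbol v_{(1,2)}=\boldsymbol v+\frac{\beta_2-\beta_1}{1-\boldsymbol u_{(1)}\cdot\boldsymbol v_{(2)}}\boldsymbol v_{(2)},$$ then, with $U=\operatorname{diag}(u^1,\dots,u^n)$ and similarly for the other vectors, the matrices $$(X^1,X^2)=(UU_{(1)}^{-1},\,VU_{(1)}),\quad (Y^1,Y^2)=(U_{(2)}U^{-1},\,UV_{(2)}),$$ $$(P^1,P^2)=(U_{(2)}U_{(1,2)}^{-1},\,V_{(2)}U_{(1,2)}),\quad (Q^1,Q^2)=(U_{(1,2)}U_{(1)}^{-1},\,U_{(1)}V_{(1,2)})$$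 are related by $(P,Q)=R(\beta_1,\beta_2)(X,Y)$; (b) $R$ satisfies the parameter-dependent Yang-Baxter relation $$R^{(2,3)}(\beta_2,\beta_3)\,R^{(1,3)}(\beta_1,\beta_3)\,R^{(1,2)}(\beta_1,\beta_2)=R^{(1,2)}(\beta_1,\beta_2)\,R^{(1,3)}(\beta_1,\beta_3)\,R^{(2,3)}(\beta_2,\beta_3).$$
   Context: Upper indices on $X,Y,P,Q$ and on vector components are labels, not powers (except ${}^{-1}$, which denotes matrix inverse); $X=(X^1,X^2)$, etc. $I$ is the $n\times n$ identity matrix; $\boldsymbol a\cdot\boldsymbol b=\sum_i a^ib^i$ is the Euclidean (bilinear) inner product. Identities are understood for generic values, where all expressions are defined (equalities of rational maps). $R^{(i,j)}$ acts on triples $(X,Y,Z)$, each entry a pair of diagonal matrices, as $R$ on the $i$-th and $j$-th entries (in this order) and as the identity on the remaining entry; products are compositions. Subscripts in parentheses are just names for the (shifted) field values on the vertices of an elementary square. *)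

theory Defs
  imports "HOL-Analysis.Analysis"
begin

type_synonym 'n cmat = "complex ^ 'n ^ 'n"

definition diag :: "complex ^ 'n \<Rightarrow> ('n::finite) cmat" where
  "diag v = (\<chi> i j. if i = j then v $ i else 0)"

definition is_diag :: "('n::finite) cmat \<Rightarrow> bool" where
  "is_diag A \<longleftrightarrow> (\<forall>i j. i \<noteq> j \<longrightarrow> A $ i $ j = 0)"

(* The bilinear product; the library's inner product on complex ^ 'n is real-valued. *)
definition bdot :: "complex ^ 'n \<Rightarrow> complex ^ 'n \<Rightarrow> complex" where
  "bdot a b = (\<Sum>i\<in>UNIV. a $ i * b $ i)"

(* mat c is the scalar matrix c I. *)
definition S_mat :: "complex \<Rightarrow> complex \<Rightarrow> ('n::finite) cmat \<Rightarrow> 'n cmat \<Rightarrow> 'n cmat" where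
  "S_mat \<beta>1 \<beta>2 X1 Y2 =
     mat 1 + mat ((\<beta>1 - \<beta>2) / (1 - trace (Y2 ** matrix_inv X1))) ** matrix_inv X1"

(* Rational maps are partial functions. The value is None exactly when the arguments are
   not diagonal, a denominator vanishes or a matrix to be inverted is singular. *)
definition R_map :: "complex \<Rightarrow> complex \<Rightarrow>
    (('n::finite) cmat \<times> 'n cmat) \<times> ('n cmat \<times> 'n cmat) \<rightharpoonup> ('n cmat \<times> 'n cmat) \<times> ('n cmat \<times> 'n cmat)" where
  "R_map \<beta>1 \<beta>2 = (\<lambda>((X1, X2), (Y1, Y2)).
     let S = S_mat \<beta>1 \<beta>2 X1 Y2 in
     if is_diag X1 \<and> is_diag X2 \<and> is_diag Y1 \<and> is_diag Y2 \<and>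
        invertible X1 \<and> 1 - trace (Y2 ** matrix_inv X1) \<noteq> 0 \<and> invertible S
     then Some ((Y1 ** matrix_inv S, Y2 ** S), (X1 ** S, X2 + Y2 ** (mat 1 - S)))
     else None)"

definition act12 :: "('p \<times> 'p \<rightharpoonup> 'p \<times> 'p) \<Rightarrow> 'p \<times> 'p \<times> 'p \<rightharpoonup> 'p \<times> 'p \<times> 'p" where
  "act12 r = (\<lambda>(x, y, z). map_option (\<lambda>(p, q). (p, q, z)) (r (x, y)))"

definition act13 :: "('p \<times> 'p \<rightharpoonup> 'p \<times> 'p) \<Rightarrow> 'p \<times> 'p \<times> 'p \<rightharpoonup> 'p \<times> 'p \<times> 'p" where
  "act13 r = (\<lambda>(x, y, z). map_option (\<lambda>(p, q). (p, y, q)) (r (x, z)))"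

definition act23 :: "('p \<times> 'p \<rightharpoonup> 'p \<times> 'p) \<Rightarrow> 'p \<times> 'p \<times> 'p \<rightharpoonup> 'p \<times> 'p \<times> 'p" where
  "act23 r = (\<lambda>(x, y, z). map_option (\<lambda>(p, q). (x, p, q)) (r (y, z)))"

definition diag_triples ::
    "((('n::finite) cmat \<times> 'n cmat) \<times> ('n cmat \<times> 'n cmat) \<times> ('n cmat \<times> 'n cmat)) set" where
  "diag_triples = {((X1, X2), (Y1, Y2), (Z1, Z2)).
     is_diag X1 \<and> is_diag X2 \<and> is_diag Y1 \<and> is_diag Y2 \<and> is_diag Z1 \<and> is_diag Z2}"

(* Equality of the rational maps f and g on the ambient space D: both are defined at a
   generic point of D, and they agree wherever both are defined. The domain of a composition
   of rational maps is Zariski-constructible, so for an affine space D Euclidean density of the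
   common domain is the same as its containing a nonempty Zariski-open set. *)
definition rat_eq_on :: "'a::topological_space set \<Rightarrow> ('a \<rightharpoonup> 'b) \<Rightarrow> ('a \<rightharpoonup> 'b) \<Rightarrow> bool" where
  "rat_eq_on D f g \<longleftrightarrow>
     D \<subseteq> closure (D \<inter> dom f \<inter> dom g) \<and> (\<forall>w \<in> D \<inter> dom f \<inter> dom g. f w = g w)"

end

theory Submission
  imports Defs
begin

text \<open>
  Diagonal matrices multiply entrywise, so \<open>R\<close> can be computed one component at a time. The
  components interact only through the trace, that is, through one scalar
  \<open>c = (\<beta>1 - \<beta>2) / (1 - (\<Sum>i. y2\<^sub>i / x1\<^sub>i))\<close>. In terms of this scalar \<open>R\<close> is
  \<open>P = (y1 x1 / (x1 + c), y2 (x1 + c) / x1)\<close> and \<open>Q = (x1 + c, x2 - c y2 / x1)\<close>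
  in each component (lemma \<open>R_map_diag\<close>). The evaluation on a lattice square
  (lemma \<open>R_map_lattice\<close>) is then a substitution, because the trace becomes \<open>u1 \<cdot> v2\<close> and
  \<open>S\<close> becomes \<open>U12 U\<^sup>-\<^sup>1\<close>.

  For the Yang-Baxter relation, each threefold composition meets three scalars in turn, say
  \<open>c, d, e\<close> on the left and \<open>c', d', e'\<close> on the right. All of them are rational functions of the
  three sums \<open>A = \<Sum> y2/x1\<close>, \<open>B = \<Sum> z2/y1\<close>, \<open>C = \<Sum> z2/(x1 y1)\<close> alone. Both compositions
  can be written in one common shape, \<open>normal_form\<close>, that depends on the scalars only through
  four quantities: \<open>d, d c, c + e, e d\<close> on the left and \<open>c' + e', e' d', d', d' c'\<close> on the right
  (lemmas \<open>lhs_Some_iff\<close> and \<open>rhs_Some_iff\<close>). The relation thus reduces to four equations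
  between numbers, whatever the size of the matrices; they are part of \<open>scalar_identities\<close>.

  It remains to see that both compositions are defined at a generic point. At points with
  \<open>y2 = z2 = 0\<close> all sums vanish and the conditions involve only \<open>x1\<close> and \<open>y1\<close>. A given point is
  therefore approached in three steps: shift \<open>x1\<close> by a scalar, then \<open>y1\<close> by a scalar,
  then multiply \<open>y2\<close> and \<open>z2\<close> by a number \<open>\<tau>\<close>. In each step only finitely many values of the
  parameter are bad; in the last one because every condition is a polynomial in \<open>\<tau>\<close> that does
  not vanish at \<open>\<tau> = 0\<close> (lemmas \<open>common_domain_scaled\<close> and \<open>common_domain_dense\<close>).
\<close>

section \<open>The map on diagonal matrices in coordinates\<close>

lemma is_diag_diag [simp]: "is_diag (diag v)"
  by (simp add: is_diag_def diag_def)

lemma is_diag_obtain: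
  assumes "is_diag A"
  obtains v where "A = diag v"
proof
  show "A = diag (\<chi> i. A $ i $ i)"
    using assms by (auto simp: is_diag_def diag_def vec_eq_iff)
qed

lemma diag_inject: "diag (\<chi> i. f i) = diag (\<chi> i. g i) \<longleftrightarrow> (\<forall>i. f i = g i)"
  by (force simp: diag_def vec_eq_iff)

lemma diag_mult: "diag u ** diag v = diag (\<chi> i. u $ i * v $ i)"
  by (simp add: diag_def matrix_matrix_mult_def vec_eq_iff if_distrib [of "\<lambda>x. x * _"]
      if_distrib [of "\<lambda>x. _ * x"] cong: if_cong)

lemma diag_add: "diag u + diag v = diag (\<chi> i. u $ i + v $ i)"
  by (simp add: diag_def vec_eq_iff)

lemma diag_diff: "diag u - diag v = diag (\<chi> i. u $ i - v $ i)"
  by (simp add: diag_def vec_eq_iff)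

lemma mat_eq_diag: "mat c = diag (\<chi> i. c)"
  by (simp add: diag_def mat_def vec_eq_iff)

lemma trace_diag: "trace (diag v) = (\<Sum>i\<in>UNIV. v $ i)"
  by (simp add: diag_def trace_def)

lemma invertible_diag_iff: "invertible (diag v) \<longleftrightarrow> (\<forall>i. v $ i \<noteq> 0)"
proof -
  have "det (diag v) = (\<Prod>i\<in>UNIV. v $ i)"
    by (subst det_diagonal) (auto simp: diag_def)
  then show ?thesis
    by (simp add: invertible_det_nz)
qed

lemma matrix_inv_diag:
  assumes "\<forall>i. v $ i \<noteq> 0"
  shows "matrix_inv (diag v) = diag (\<chi> i. 1 / v $ i)"
proof -
  have "diag v ** diag (\<chi> i. 1 / v $ i) = mat 1" "diag (\<chi> i. 1 / v $ i) ** diag v = mat 1"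
    using assms by (simp_all add: diag_mult mat_eq_diag)
  then show ?thesis
    unfolding matrix_inv_def
    by (intro some_equality) (auto, metis matrix_mul_assoc matrix_mul_lid matrix_mul_rid)
qed

text \<open>
  The statement decides definedness and value together, so that the domains of compositions
  can be read off. The factor \<open>S\<close> has the entries \<open>(x1\<^sub>i + c) / x1\<^sub>i\<close>.
\<close>
lemma R_map_diag:
  fixes x1 x2 y1 y2 :: "complex ^ ('n::finite)"
  assumes c: "c = (\<beta>1 - \<beta>2) / (1 - (\<Sum>i\<in>UNIV. y2 $ i / x1 $ i))"
  shows "R_map \<beta>1 \<beta>2 ((diag x1, diag x2), (diag y1, diag y2)) = Some v \<longleftrightarrow>
    (\<forall>i. x1 $ i \<noteq> 0) \<and> 1 - (\<Sum>i\<in>UNIV. y2 $ i / x1 $ i) \<noteq> 0 \<and> (\<forall>i. x1 $ i + c \<noteq> 0) \<and>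
    v = ((diag (\<chi> i. y1 $ i * x1 $ i / (x1 $ i + c)), diag (\<chi> i. y2 $ i * (x1 $ i + c) / x1 $ i)),
         (diag (\<chi> i. x1 $ i + c), diag (\<chi> i. x2 $ i - c * y2 $ i / x1 $ i)))"
proof (cases "\<forall>i. x1 $ i \<noteq> 0")
  case False
  then show ?thesis
    by (auto simp: R_map_def Let_def invertible_diag_iff)
next
  case True
  let ?s = "\<chi> i. (x1 $ i + c) / x1 $ i"
  have inv: "matrix_inv (diag x1) = diag (\<chi> i. 1 / x1 $ i)"
    by (rule matrix_inv_diag [OF True])
  have tr: "trace (diag y2 ** matrix_inv (diag x1)) = (\<Sum>i\<in>UNIV. y2 $ i / x1 $ i)"
    by (simp add: inv diag_mult trace_diag)
  have S: "S_mat \<beta>1 \<beta>2 (diag x1) (diag y2) = diag ?s"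
    using True unfolding S_mat_def tr c [symmetric]
    by (simp add: inv mat_eq_diag diag_mult diag_add diag_inject field_simps)
  have invS: "invertible (diag ?s) \<longleftrightarrow> (\<forall>i. x1 $ i + c \<noteq> 0)"
    using True by (simp add: invertible_diag_iff)
  have entries: "((diag y1 ** matrix_inv (diag ?s), diag y2 ** diag ?s),
         (diag x1 ** diag ?s, diag x2 + diag y2 ** (mat 1 - diag ?s)))
     = ((diag (\<chi> i. y1 $ i * x1 $ i / (x1 $ i + c)), diag (\<chi> i. y2 $ i * (x1 $ i + c) / x1 $ i)),
         (diag (\<chi> i. x1 $ i + c), diag (\<chi> i. x2 $ i - c * y2 $ i / x1 $ i)))"
    if "\<forall>i. x1 $ i + c \<noteq> 0"
    using True that
    by (simp add: matrix_inv_diag mat_eq_diag diag_mult diag_add diag_diff diag_inject field_simps)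
  show ?thesis
    using True entries unfolding R_map_def Let_def by (auto simp: S tr invS invertible_diag_iff)
qed

section \<open>Evaluation on an elementary lattice square\<close>

lemma R_map_lattice:
  fixes u v u1 u2 v2 u12 v12 :: "complex ^ ('n::finite)"
  assumes inv: "invertible (diag u)" "invertible (diag u1)" "invertible (diag u12)"
    and nz: "1 - bdot u1 v2 \<noteq> 0"
    and u12: "u12 = u + ((\<beta>1 - \<beta>2) / (1 - bdot u1 v2)) *s u1"
    and v12: "v12 = v + ((\<beta>2 - \<beta>1) / (1 - bdot u1 v2)) *s v2"
  shows "R_map \<beta>1 \<beta>2
          ((diag u ** matrix_inv (diag u1), diag v ** diag u1),
           (diag u2 ** matrix_inv (diag u), diag u ** diag v2))
        = Some
          ((diag u2 ** matrix_inv (diag u12), diag v2 ** diag u12),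
           (diag u12 ** matrix_inv (diag u1), diag u1 ** diag v12))"
proof -
  define c where "c = (\<beta>1 - \<beta>2) / (1 - bdot u1 v2)"
  have nonzero: "\<And>i. u $ i \<noteq> 0" "\<And>i. u1 $ i \<noteq> 0" "\<And>i. u12 $ i \<noteq> 0"
    using inv by (auto simp: invertible_diag_iff)
  have u12_nth: "u12 $ i = u $ i + c * u1 $ i" for i
    by (simp add: u12 c_def)
  have v12_nth: "v12 $ i = v $ i - c * v2 $ i" for i
  proof -
    have "(\<beta>2 - \<beta>1) / (1 - bdot u1 v2) = - c"
      by (simp add: c_def minus_divide_left)
    then show ?thesis
      by (simp add: v12)
  qed
  have sum: "(\<Sum>i\<in>UNIV. (\<chi> i. u $ i * v2 $ i) $ i / (\<chi> i. u $ i / u1 $ i) $ i) = bdot u1 v2"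
    unfolding bdot_def by (rule sum.cong) (use nonzero in auto)
  have shift: "u $ i / u1 $ i + c = u12 $ i / u1 $ i" for i
    using nonzero [of i] by (simp add: u12_nth field_simps)
  have matrices: "diag u ** matrix_inv (diag u1) = diag (\<chi> i. u $ i / u1 $ i)"
    "diag u2 ** matrix_inv (diag u) = diag (\<chi> i. u2 $ i / u $ i)"
    "diag u2 ** matrix_inv (diag u12) = diag (\<chi> i. u2 $ i / u12 $ i)"
    "diag u12 ** matrix_inv (diag u1) = diag (\<chi> i. u12 $ i / u1 $ i)"
    using nonzero by (simp_all add: matrix_inv_diag diag_mult)
  show ?thesis
    unfolding matrices diag_mult
  proof (subst R_map_diag, unfold sum, rule c_def, intro conjI)
    show "\<forall>i. (\<chi> i. u $ i / u1 $ i) $ i \<noteq> 0" "\<forall>i. (\<chi> i. u $ i / u1 $ i) $ i + c \<noteq> 0"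
      using nonzero by (simp_all add: shift)
    have "v $ i * u1 $ i - c * (u $ i * v2 $ i) / (u $ i / u1 $ i) = u1 $ i * v12 $ i" for i
      using nonzero [of i] by (simp add: v12_nth field_simps)
    then show "((diag (\<chi> i. u2 $ i / u12 $ i), diag (\<chi> i. v2 $ i * u12 $ i)),
        diag (\<chi> i. u12 $ i / u1 $ i), diag (\<chi> i. u1 $ i * v12 $ i)) =
      ((diag (\<chi> i. (\<chi> i. u2 $ i / u $ i) $ i * (\<chi> i. u $ i / u1 $ i) $ i / ((\<chi> i. u $ i / u1 $ i) $ i + c)),
        diag (\<chi> i. (\<chi> i. u $ i * v2 $ i) $ i * ((\<chi> i. u $ i / u1 $ i) $ i + c) / (\<chi> i. u $ i / u1 $ i) $ i)),
        diag (\<chi> i. (\<chi> i. u $ i / u1 $ i) $ i + c),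
        diag (\<chi> i. (\<chi> i. v $ i * u1 $ i) $ i - c * (\<chi> i. u $ i * v2 $ i) $ i / (\<chi> i. u $ i / u1 $ i) $ i))"
      using nonzero by (simp add: shift diag_inject)
  qed (rule nz)
qed

section \<open>The two threefold compositions\<close>

lemma act12_Some_iff:
  "act12 r (x, y, z) = Some v \<longleftrightarrow> (\<exists>p q. r (x, y) = Some (p, q) \<and> v = (p, q, z))"
  by (auto simp: act12_def)

lemma act13_Some_iff:
  "act13 r (x, y, z) = Some v \<longleftrightarrow> (\<exists>p q. r (x, z) = Some (p, q) \<and> v = (p, y, q))"
  by (auto simp: act13_def)

lemma act23_Some_iff:
  "act23 r (x, y, z) = Some v \<longleftrightarrow> (\<exists>p q. r (y, z) = Some (p, q) \<and> v = (x, p, q))"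
  by (auto simp: act23_def)

lemma map_comp3_Some_iff:
  assumes "\<And>w. f x = Some w \<longleftrightarrow> P \<and> w = a"
    and "\<And>w. P \<Longrightarrow> g a = Some w \<longleftrightarrow> Q \<and> w = b"
    and "\<And>w. P \<Longrightarrow> Q \<Longrightarrow> h b = Some w \<longleftrightarrow> R \<and> w = c"
  shows "(h \<circ>\<^sub>m (g \<circ>\<^sub>m f)) x = Some v \<longleftrightarrow> P \<and> Q \<and> R \<and> v = c"
  using assms unfolding map_comp_Some_iff by metis

text \<open>
  The letters \<open>x, y, z\<close> are the initial values, and \<open>m, k, h, g\<close> are the four quantities through
  which the value of a threefold composition depends on the scalars of its three factors.
\<close>
definition normal_form where
  "normal_form x1 x2 y1 y2 z1 z2 m k h g =
    ((diag (\<chi> i. z1 $ i * (x1 $ i * y1 $ i) / (x1 $ i * y1 $ i + m * x1 $ i + k)),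
      diag (\<chi> i. z2 $ i * (x1 $ i * y1 $ i + m * x1 $ i + k) / (x1 $ i * y1 $ i))),
     (diag (\<chi> i. (x1 $ i * y1 $ i + m * x1 $ i + k) / (x1 $ i + h)),
      diag (\<chi> i. (y2 $ i - m * z2 $ i / y1 $ i) * (x1 $ i + h) / x1 $ i)),
     (diag (\<chi> i. x1 $ i + h),
      diag (\<chi> i. x2 $ i - h * y2 $ i / x1 $ i + g * z2 $ i / (x1 $ i * y1 $ i))))"

text \<open>
  The scalars \<open>d\<close> and \<open>e\<close> of the second and third factor are defined through traces of intermediate
  values. The summands of these traces are combinations of the
  summands of \<open>A\<close>, \<open>B\<close>, \<open>C\<close>: in the second step \<open>z2/y1 + c z2/(x1 y1)\<close>, in the third
  \<open>y2/x1 - d z2/(x1 y1)\<close>. Hence the traces are \<open>B + c C\<close> and \<open>A - d C\<close>.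
\<close>
lemma lhs_Some_iff:
  fixes x1 x2 y1 y2 z1 z2 :: "complex ^ ('n::finite)"
  assumes A: "A = (\<Sum>i\<in>UNIV. y2 $ i / x1 $ i)"
    and B: "B = (\<Sum>i\<in>UNIV. z2 $ i / y1 $ i)"
    and C: "C = (\<Sum>i\<in>UNIV. z2 $ i / (x1 $ i * y1 $ i))"
    and c: "c = (\<beta>1 - \<beta>2) / (1 - A)"
    and d: "d = (\<beta>1 - \<beta>3) / (1 - (B + c * C))"
    and e: "e = (\<beta>2 - \<beta>3) / (1 - (A - d * C))"
  shows "(act23 (R_map \<beta>2 \<beta>3) \<circ>\<^sub>m (act13 (R_map \<beta>1 \<beta>3) \<circ>\<^sub>m act12 (R_map \<beta>1 \<beta>2)))
      ((diag x1, diag x2), (diag y1, diag y2), (diag z1, diag z2)) = Some v \<longleftrightarrow>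
    ((\<forall>i. x1 $ i \<noteq> 0) \<and> 1 - A \<noteq> 0 \<and> (\<forall>i. x1 $ i + c \<noteq> 0)) \<and>
    ((\<forall>i. y1 $ i \<noteq> 0) \<and> 1 - (B + c * C) \<noteq> 0 \<and>
      (\<forall>i. x1 $ i * y1 $ i + d * x1 $ i + d * c \<noteq> 0)) \<and>
    (1 - (A - d * C) \<noteq> 0 \<and> (\<forall>i. x1 $ i + (c + e) \<noteq> 0)) \<and>
    v = normal_form x1 x2 y1 y2 z1 z2 d (d * c) (c + e) (e * d)"
    (is "(_ \<circ>\<^sub>m _) ?w = _ \<longleftrightarrow> ?L1 \<and> ?L2 \<and> ?L3 \<and> v = ?v")
proof -
  define X1 where "X1 = (\<chi> i. y1 $ i * x1 $ i / (x1 $ i + c))"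
  define X2 where "X2 = (\<chi> i. y2 $ i * (x1 $ i + c) / x1 $ i)"
  define Y1 where "Y1 = (\<chi> i. x1 $ i + c)"
  define Y2 where "Y2 = (\<chi> i. x2 $ i - c * y2 $ i / x1 $ i)"
  define Z1 where "Z1 = (\<chi> i. X1 $ i + d)"
  define Z2 where "Z2 = (\<chi> i. X2 $ i - d * z2 $ i / X1 $ i)"
  note defs = X1_def X2_def Y1_def Y2_def Z1_def Z2_def
  define w1 where "w1 = ((diag X1, diag X2), (diag Y1, diag Y2), (diag z1, diag z2))"
  define w2 where "w2 = ((diag (\<chi> i. z1 $ i * X1 $ i / (X1 $ i + d)), diag (\<chi> i. z2 $ i * (X1 $ i + d) / X1 $ i)),
     (diag Y1, diag Y2), (diag Z1, diag Z2))"
  have step1: "act12 (R_map \<beta>1 \<beta>2) ?w = Some w \<longleftrightarrow> ?L1 \<and> w = w1" for w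
    unfolding act12_Some_iff R_map_diag [OF c [unfolded A]] w1_def defs by (auto simp: A)
  have step2: "act13 (R_map \<beta>1 \<beta>3) w1 = Some w \<longleftrightarrow> ?L2 \<and> w = w2" if L1: ?L1 for w
  proof -
    have "z2 $ i / X1 $ i = z2 $ i / y1 $ i + c * (z2 $ i / (x1 $ i * y1 $ i))" for i
      using L1 by (cases "y1 $ i = 0") (simp_all add: X1_def field_simps)
    then have sum: "(\<Sum>i\<in>UNIV. z2 $ i / X1 $ i) = B + c * C"
      by (simp add: B C sum.distrib sum_distrib_left)
    have nz: "X1 $ i \<noteq> 0 \<longleftrightarrow> y1 $ i \<noteq> 0"
      "X1 $ i + d \<noteq> 0 \<longleftrightarrow> x1 $ i * y1 $ i + d * x1 $ i + d * c \<noteq> 0" for i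
      using L1 by (auto simp: X1_def field_simps)
    have d': "d = (\<beta>1 - \<beta>3) / (1 - (\<Sum>i\<in>UNIV. z2 $ i / X1 $ i))"
      by (simp add: d sum)
    show ?thesis
      unfolding act13_Some_iff w1_def R_map_diag [OF d'] w2_def Z1_def Z2_def sum nz by auto
  qed
  have step3: "act23 (R_map \<beta>2 \<beta>3) w2 = Some w \<longleftrightarrow> ?L3 \<and> w = ?v" if L1: ?L1 and L2: ?L2 for w
  proof -
    have nz: "x1 $ i \<noteq> 0" "y1 $ i \<noteq> 0" "x1 $ i + c \<noteq> 0"
      "x1 $ i * y1 $ i + d * x1 $ i + d * c \<noteq> 0" for i
      using L1 L2 by auto
    have X1: "X1 $ i + d = (x1 $ i * y1 $ i + d * x1 $ i + d * c) / (x1 $ i + c)" for i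
      using nz [of i] by (simp add: X1_def field_simps)
    have quot: "Z2 $ i / Y1 $ i = y2 $ i / x1 $ i - d * (z2 $ i / (x1 $ i * y1 $ i))" for i
      using nz [of i] by (simp add: defs diff_divide_distrib mult.commute)
    then have sum: "(\<Sum>i\<in>UNIV. Z2 $ i / Y1 $ i) = A - d * C"
      by (simp add: A C sum_subtractf sum_distrib_left)
    have e': "e = (\<beta>2 - \<beta>3) / (1 - (\<Sum>i\<in>UNIV. Z2 $ i / Y1 $ i))"
      by (simp add: e sum)
    have Y1: "Y1 $ i \<noteq> 0" "Y1 $ i + e = x1 $ i + (c + e)" for i
      using nz [of i] by (simp_all add: Y1_def)
    have v: "?v = ((diag (\<chi> i. z1 $ i * X1 $ i / (X1 $ i + d)), diag (\<chi> i. z2 $ i * (X1 $ i + d) / X1 $ i)),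
      (diag (\<chi> i. Z1 $ i * Y1 $ i / (Y1 $ i + e)), diag (\<chi> i. Z2 $ i * (Y1 $ i + e) / Y1 $ i)),
      (diag (\<chi> i. Y1 $ i + e), diag (\<chi> i. Y2 $ i - e * Z2 $ i / Y1 $ i)))"
    proof -
      have "z1 $ i * (x1 $ i * y1 $ i) / (x1 $ i * y1 $ i + d * x1 $ i + d * c)
          = z1 $ i * X1 $ i / (X1 $ i + d)" for i
        unfolding X1 using nz [of i] by (simp add: X1_def)
      moreover have "z2 $ i * (x1 $ i * y1 $ i + d * x1 $ i + d * c) / (x1 $ i * y1 $ i)
          = z2 $ i * (X1 $ i + d) / X1 $ i" for i
        unfolding X1 using nz [of i] by (simp add: X1_def mult.commute)
      moreover have "(x1 $ i * y1 $ i + d * x1 $ i + d * c) / (x1 $ i + (c + e))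
          = Z1 $ i * Y1 $ i / (Y1 $ i + e)" for i
        using nz [of i] by (simp add: Y1(2) Z1_def X1) (simp add: Y1_def)
      moreover have "(y2 $ i - d * z2 $ i / y1 $ i) * (x1 $ i + (c + e)) / x1 $ i
          = Z2 $ i * (Y1 $ i + e) / Y1 $ i" for i
      proof -
        have "Z2 $ i * (Y1 $ i + e) / Y1 $ i = (Z2 $ i / Y1 $ i) * (x1 $ i + (c + e))"
          by (simp add: Y1(2))
        also have "\<dots> = (y2 $ i - d * z2 $ i / y1 $ i) * (x1 $ i + (c + e)) / x1 $ i"
          unfolding quot using nz [of i] by (simp add: field_simps)
        finally show ?thesis ..
      qed
      moreover have "x2 $ i - (c + e) * y2 $ i / x1 $ i + e * d * z2 $ i / (x1 $ i * y1 $ i)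
          = Y2 $ i - e * Z2 $ i / Y1 $ i" for i
      proof -
        have "Y2 $ i - e * Z2 $ i / Y1 $ i = Y2 $ i - e * (Z2 $ i / Y1 $ i)"
          by simp
        also have "\<dots> = x2 $ i - (c + e) * y2 $ i / x1 $ i + e * d * z2 $ i / (x1 $ i * y1 $ i)"
          unfolding quot Y2_def using nz [of i] by (simp add: field_simps)
        finally show ?thesis ..
      qed
      ultimately show ?thesis
        by (simp add: normal_form_def Y1(2) diag_inject)
    qed
    show ?thesis
      unfolding act23_Some_iff w2_def R_map_diag [OF e'] sum v using Y1 by (auto simp: add.assoc)
  qed
  show ?thesis
  proof (rule map_comp3_Some_iff [where a = w1 and b = w2])
  qed (rule step1, rule step2, assumption, rule step3, assumption+)
qed

text \<open>
  Here the summands of the traces are \<open>y2/x1 - c z2/(x1 y1)\<close> in the second step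
  and \<open>z2/y1 + d z2/(x1 y1)\<close> in the third.
\<close>
lemma rhs_Some_iff:
  fixes x1 x2 y1 y2 z1 z2 :: "complex ^ ('n::finite)"
  assumes A: "A = (\<Sum>i\<in>UNIV. y2 $ i / x1 $ i)"
    and B: "B = (\<Sum>i\<in>UNIV. z2 $ i / y1 $ i)"
    and C: "C = (\<Sum>i\<in>UNIV. z2 $ i / (x1 $ i * y1 $ i))"
    and c: "c = (\<beta>2 - \<beta>3) / (1 - B)"
    and d: "d = (\<beta>1 - \<beta>3) / (1 - (A - c * C))"
    and e: "e = (\<beta>1 - \<beta>2) / (1 - (B + d * C))"
  shows "(act12 (R_map \<beta>1 \<beta>2) \<circ>\<^sub>m (act13 (R_map \<beta>1 \<beta>3) \<circ>\<^sub>m act23 (R_map \<beta>2 \<beta>3)))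
      ((diag x1, diag x2), (diag y1, diag y2), (diag z1, diag z2)) = Some v \<longleftrightarrow>
    ((\<forall>i. y1 $ i \<noteq> 0) \<and> 1 - B \<noteq> 0 \<and> (\<forall>i. y1 $ i + c \<noteq> 0)) \<and>
    ((\<forall>i. x1 $ i \<noteq> 0) \<and> 1 - (A - c * C) \<noteq> 0 \<and> (\<forall>i. x1 $ i + d \<noteq> 0)) \<and>
    (1 - (B + d * C) \<noteq> 0 \<and> (\<forall>i. x1 $ i * y1 $ i + (c + e) * x1 $ i + e * d \<noteq> 0)) \<and>
    v = normal_form x1 x2 y1 y2 z1 z2 (c + e) (e * d) d (d * c)"
    (is "(_ \<circ>\<^sub>m _) ?w = _ \<longleftrightarrow> ?L1 \<and> ?L2 \<and> ?L3 \<and> v = ?v")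
proof -
  define Y1 where "Y1 = (\<chi> i. z1 $ i * y1 $ i / (y1 $ i + c))"
  define Y2 where "Y2 = (\<chi> i. z2 $ i * (y1 $ i + c) / y1 $ i)"
  define Z1 where "Z1 = (\<chi> i. y1 $ i + c)"
  define Z2 where "Z2 = (\<chi> i. y2 $ i - c * z2 $ i / y1 $ i)"
  define X1 where "X1 = (\<chi> i. Z1 $ i * x1 $ i / (x1 $ i + d))"
  define X2 where "X2 = (\<chi> i. Z2 $ i * (x1 $ i + d) / x1 $ i)"
  note defs = X1_def X2_def Y1_def Y2_def Z1_def Z2_def
  define w1 where "w1 = ((diag x1, diag x2), (diag Y1, diag Y2), (diag Z1, diag Z2))"
  define w2 where "w2 = ((diag X1, diag X2), (diag Y1, diag Y2),
     (diag (\<chi> i. x1 $ i + d), diag (\<chi> i. x2 $ i - d * Z2 $ i / x1 $ i)))"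
  have step1: "act23 (R_map \<beta>2 \<beta>3) ?w = Some w \<longleftrightarrow> ?L1 \<and> w = w1" for w
    unfolding act23_Some_iff R_map_diag [OF c [unfolded B]] w1_def defs by (auto simp: B)
  have step2: "act13 (R_map \<beta>1 \<beta>3) w1 = Some w \<longleftrightarrow> ?L2 \<and> w = w2" if L1: ?L1 for w
  proof -
    have "Z2 $ i / x1 $ i = y2 $ i / x1 $ i - c * (z2 $ i / (x1 $ i * y1 $ i))" for i
      using L1 by (cases "x1 $ i = 0") (simp_all add: Z2_def field_simps)
    then have sum: "(\<Sum>i\<in>UNIV. Z2 $ i / x1 $ i) = A - c * C"
      by (simp add: A C sum_subtractf sum_distrib_left)
    have d': "d = (\<beta>1 - \<beta>3) / (1 - (\<Sum>i\<in>UNIV. Z2 $ i / x1 $ i))"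
      by (simp add: d sum)
    show ?thesis
      unfolding act13_Some_iff w1_def R_map_diag [OF d'] w2_def X1_def X2_def sum by auto
  qed
  have step3: "act12 (R_map \<beta>1 \<beta>2) w2 = Some w \<longleftrightarrow> ?L3 \<and> w = ?v" if L1: ?L1 and L2: ?L2 for w
  proof -
    have nz: "x1 $ i \<noteq> 0" "y1 $ i \<noteq> 0" "y1 $ i + c \<noteq> 0" "x1 $ i + d \<noteq> 0" for i
      using L1 L2 by auto
    have X1: "X1 $ i \<noteq> 0"
      "X1 $ i + e = (x1 $ i * y1 $ i + (c + e) * x1 $ i + e * d) / (x1 $ i + d)" for i
      using nz [of i] by (simp add: X1_def Z1_def) (use nz [of i] in \<open>simp add: X1_def Z1_def field_simps\<close>)
    have X1_nz: "X1 $ i + e \<noteq> 0 \<longleftrightarrow> x1 $ i * y1 $ i + (c + e) * x1 $ i + e * d \<noteq> 0" for i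
      unfolding X1 using nz [of i] by simp
    have quot: "Y2 $ i / X1 $ i = z2 $ i / y1 $ i + d * (z2 $ i / (x1 $ i * y1 $ i))" for i
    proof -
      have "Y2 $ i / X1 $ i = z2 $ i * (x1 $ i + d) / (x1 $ i * y1 $ i)"
        using nz [of i] by (simp add: X1_def Z1_def Y2_def mult.commute)
      then show ?thesis
        using nz [of i] by (simp add: field_simps)
    qed
    then have sum: "(\<Sum>i\<in>UNIV. Y2 $ i / X1 $ i) = B + d * C"
      by (simp add: B C sum.distrib sum_distrib_left)
    have e': "e = (\<beta>1 - \<beta>2) / (1 - (\<Sum>i\<in>UNIV. Y2 $ i / X1 $ i))"
      by (simp add: e sum)
    have v: "?v = ((diag (\<chi> i. Y1 $ i * X1 $ i / (X1 $ i + e)), diag (\<chi> i. Y2 $ i * (X1 $ i + e) / X1 $ i)),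
      (diag (\<chi> i. X1 $ i + e), diag (\<chi> i. X2 $ i - e * Y2 $ i / X1 $ i)),
      (diag (\<chi> i. x1 $ i + d), diag (\<chi> i. x2 $ i - d * Z2 $ i / x1 $ i)))"
    proof -
      have "z1 $ i * (x1 $ i * y1 $ i) / (x1 $ i * y1 $ i + (c + e) * x1 $ i + e * d)
          = Y1 $ i * X1 $ i / (X1 $ i + e)" for i
        unfolding X1 using nz [of i] by (simp add: X1_def Y1_def Z1_def mult.commute)
      moreover have "z2 $ i * (x1 $ i * y1 $ i + (c + e) * x1 $ i + e * d) / (x1 $ i * y1 $ i)
          = Y2 $ i * (X1 $ i + e) / X1 $ i" for i
        unfolding X1 using nz [of i] by (simp add: X1_def Y2_def Z1_def mult.commute)
      moreover have "(y2 $ i - (c + e) * z2 $ i / y1 $ i) * (x1 $ i + d) / x1 $ i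
          = X2 $ i - e * Y2 $ i / X1 $ i" for i
      proof -
        have "X2 $ i - e * Y2 $ i / X1 $ i = X2 $ i - e * (Y2 $ i / X1 $ i)"
          by simp
        also have "\<dots> = (y2 $ i - (c + e) * z2 $ i / y1 $ i) * (x1 $ i + d) / x1 $ i"
          unfolding quot X2_def Z2_def using nz [of i] by (simp add: field_simps)
        finally show ?thesis ..
      qed
      moreover have "x2 $ i - d * y2 $ i / x1 $ i + d * c * z2 $ i / (x1 $ i * y1 $ i)
          = x2 $ i - d * Z2 $ i / x1 $ i" for i
        unfolding Z2_def using nz [of i] by (simp add: field_simps)
      ultimately show ?thesis
        by (simp add: normal_form_def X1(2) diag_inject)
    qed
    show ?thesis
      unfolding act12_Some_iff w2_def R_map_diag [OF e'] sum v X1_nz using X1(1) by auto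
  qed
  show ?thesis
  proof (rule map_comp3_Some_iff [where a = w1 and b = w2])
  qed (rule step1, rule step2, assumption, rule step3, assumption+)
qed

section \<open>The scalar identities behind the Yang-Baxter relation\<close>

text \<open>
  The letters \<open>p\<close> and \<open>q\<close> stand for \<open>1 - A\<close> and \<open>1 - B\<close>. In \<open>d, e, d', e'\<close> the only other
  factors that depend on \<open>p, q, C\<close> are \<open>M = p q - a C\<close> and \<open>N = p q + b C\<close>. The two products then
  agree by cancellation, and the two sums because of \<open>b M + a N = (a + b) p q\<close>. The last four equations match the arguments
  of \<open>normal_form\<close> on both sides; the others turn the conditions for the compositions to be
  defined into polynomial ones.
\<close>
lemma scalar_identities:
  fixes a b p q C :: complex
  assumes nz: "p \<noteq> 0" "q \<noteq> 0" "p * q - a * C \<noteq> 0" "p * q + b * C \<noteq> 0"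
    and c: "c = a / p" and d: "d = (a + b) / (q - c * C)" and e: "e = b / (p + d * C)"
    and c': "c' = b / q" and d': "d' = (a + b) / (p + c' * C)" and e': "e' = a / (q - d' * C)"
  shows "q - c * C = (p * q - a * C) / p" "p + d * C = p * (p * q + b * C) / (p * q - a * C)"
    and "p + c' * C = (p * q + b * C) / q" "q - d' * C = q * (p * q - a * C) / (p * q + b * C)"
    and "d = (a + b) * p / (p * q - a * C)" "d' = (a + b) * q / (p * q + b * C)"
    and "d = c' + e'" "d * c = e' * d'" "c + e = d'" "e * d = d' * c'"
proof -
  define M where "M = p * q - a * C"
  define N where "N = p * q + b * C"
  have MN: "M \<noteq> 0" "N \<noteq> 0" using nz by (simp_all add: M_def N_def)
  have 1: "q - c * C = (p * q - a * C) / p"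
    using nz by (simp add: c field_simps)
  have 2: "d = (a + b) * p / (p * q - a * C)"
    unfolding d 1 by simp
  have d_eq: "d = (a + b) * p / M" by (simp add: 2 M_def)
  have "p + d * C = (p * M + (a + b) * p * C) / M"
    unfolding d_eq using MN by (simp add: field_simps)
  also have "p * M + (a + b) * p * C = p * N" by (simp add: M_def N_def algebra_simps)
  finally have pdC_eq: "p + d * C = p * N / M" .
  then have 3: "p + d * C = p * (p * q + b * C) / (p * q - a * C)" by (simp add: M_def N_def)
  have 4: "p + c' * C = (p * q + b * C) / q"
    using nz by (simp add: c' field_simps)
  have 5: "d' = (a + b) * q / (p * q + b * C)"
    unfolding d' 4 by simp
  have d'_eq: "d' = (a + b) * q / N" by (simp add: 5 N_def)
  have "q - d' * C = (q * N - (a + b) * q * C) / N"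
    unfolding d'_eq using MN by (simp add: field_simps)
  also have "q * N - (a + b) * q * C = q * M" by (simp add: M_def N_def algebra_simps)
  finally have qdC_eq: "q - d' * C = q * M / N" .
  then have 6: "q - d' * C = q * (p * q - a * C) / (p * q + b * C)" by (simp add: M_def N_def)
  have e_eq: "e = b * M / (p * N)" unfolding e pdC_eq by simp
  have e'_eq: "e' = a * N / (q * M)" unfolding e' qdC_eq by simp
  have key: "b * M + a * N = (a + b) * (p * q)" by (simp add: M_def N_def algebra_simps)
  have "c' + e' = (b * M + a * N) / (q * M)"
    unfolding e'_eq c' using nz MN by (simp add: field_simps)
  also have "\<dots> = d" unfolding key d_eq using nz MN by (simp add: field_simps)
  finally have 7: "d = c' + e'" ..
  have "c + e = (b * M + a * N) / (p * N)"
    unfolding e_eq c using nz MN by (simp add: field_simps)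
  also have "\<dots> = d'" unfolding key d'_eq using nz MN by (simp add: field_simps)
  finally have 8: "c + e = d'" .
  have 9: "d * c = e' * d'" unfolding d_eq c e'_eq d'_eq using nz MN by simp
  have 10: "e * d = d' * c'" unfolding d_eq c' e_eq d'_eq using nz MN by simp
  from 1 3 4 6 2 5 7 9 8 10
  show "q - c * C = (p * q - a * C) / p" "p + d * C = p * (p * q + b * C) / (p * q - a * C)"
    and "p + c' * C = (p * q + b * C) / q" "q - d' * C = q * (p * q - a * C) / (p * q + b * C)"
    and "d = (a + b) * p / (p * q - a * C)" "d' = (a + b) * q / (p * q + b * C)"
    and "d = c' + e'" "d * c = e' * d'" "c + e = d'" "e * d = d' * c'" .
qed

lemma compositions_agree:
  fixes x1 x2 y1 y2 z1 z2 :: "complex ^ ('n::finite)"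
  defines "w \<equiv> ((diag x1, diag x2), (diag y1, diag y2), (diag z1, diag z2))"
  assumes lhs: "(act23 (R_map \<beta>2 \<beta>3) \<circ>\<^sub>m (act13 (R_map \<beta>1 \<beta>3) \<circ>\<^sub>m act12 (R_map \<beta>1 \<beta>2))) w = Some v"
    and rhs: "(act12 (R_map \<beta>1 \<beta>2) \<circ>\<^sub>m (act13 (R_map \<beta>1 \<beta>3) \<circ>\<^sub>m act23 (R_map \<beta>2 \<beta>3))) w = Some v'"
  shows "v = v'"
proof -
  define A where "A = (\<Sum>i\<in>UNIV. y2 $ i / x1 $ i)"
  define B where "B = (\<Sum>i\<in>UNIV. z2 $ i / y1 $ i)"
  define C where "C = (\<Sum>i\<in>UNIV. z2 $ i / (x1 $ i * y1 $ i))"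
  define c where "c = (\<beta>1 - \<beta>2) / (1 - A)"
  define d where "d = (\<beta>1 - \<beta>3) / (1 - (B + c * C))"
  define e where "e = (\<beta>2 - \<beta>3) / (1 - (A - d * C))"
  define c' where "c' = (\<beta>2 - \<beta>3) / (1 - B)"
  define d' where "d' = (\<beta>1 - \<beta>3) / (1 - (A - c' * C))"
  define e' where "e' = (\<beta>1 - \<beta>2) / (1 - (B + d' * C))"
  have L: "1 - A \<noteq> 0" "1 - (B + c * C) \<noteq> 0"
      "v = normal_form x1 x2 y1 y2 z1 z2 d (d * c) (c + e) (e * d)"
    using lhs unfolding w_def lhs_Some_iff [OF A_def B_def C_def c_def d_def e_def] by simp_all
  have R: "1 - B \<noteq> 0" "1 - (A - c' * C) \<noteq> 0"
      "v' = normal_form x1 x2 y1 y2 z1 z2 (c' + e') (e' * d') d' (d' * c')"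
    using rhs unfolding w_def rhs_Some_iff [OF A_def B_def C_def c'_def d'_def e'_def] by simp_all
  have "(1 - A) * (1 - B) - (\<beta>1 - \<beta>2) * C = (1 - A) * (1 - (B + c * C))"
    using L(1) by (simp add: c_def field_simps)
  then have M: "(1 - A) * (1 - B) - (\<beta>1 - \<beta>2) * C \<noteq> 0"
    using L by simp
  have "(1 - A) * (1 - B) + (\<beta>2 - \<beta>3) * C = (1 - B) * (1 - (A - c' * C))"
    using R(1) by (simp add: c'_def field_simps)
  then have N: "(1 - A) * (1 - B) + (\<beta>2 - \<beta>3) * C \<noteq> 0"
    using R by simp
  have "d = ((\<beta>1 - \<beta>2) + (\<beta>2 - \<beta>3)) / (1 - B - c * C)" "e = (\<beta>2 - \<beta>3) / (1 - A + d * C)"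
    "d' = ((\<beta>1 - \<beta>2) + (\<beta>2 - \<beta>3)) / (1 - A + c' * C)" "e' = (\<beta>1 - \<beta>2) / (1 - B - d' * C)"
    by (simp_all add: d_def e_def d'_def e'_def algebra_simps)
  note scalar_identities(7-10) [OF L(1) R(1) M N c_def this(1,2) c'_def this(3,4)]
  then show ?thesis
    unfolding L(3) R(3) by simp
qed

text \<open>
  The hypotheses are the domain conditions of both compositions with denominators cleared. They
  are polynomial in \<open>p, q, C\<close>, hence in a common factor of \<open>y2\<close> and \<open>z2\<close>.
\<close>
lemma compositions_defined:
  fixes x1 x2 y1 y2 z1 z2 :: "complex ^ ('n::finite)" and \<beta>1 \<beta>2 \<beta>3 :: complex
  defines "w \<equiv> ((diag x1, diag x2), (diag y1, diag y2), (diag z1, diag z2))"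
    and "p \<equiv> 1 - (\<Sum>i\<in>UNIV. y2 $ i / x1 $ i)"
    and "q \<equiv> 1 - (\<Sum>i\<in>UNIV. z2 $ i / y1 $ i)"
    and "C \<equiv> \<Sum>i\<in>UNIV. z2 $ i / (x1 $ i * y1 $ i)"
    and "a \<equiv> \<beta>1 - \<beta>2" and "b \<equiv> \<beta>2 - \<beta>3"
  assumes nz: "\<And>i. x1 $ i \<noteq> 0" "\<And>i. y1 $ i \<noteq> 0"
    and pq: "p \<noteq> 0" "q \<noteq> 0" and MN: "p * q - a * C \<noteq> 0" "p * q + b * C \<noteq> 0"
    and gen: "\<And>i. p * x1 $ i + a \<noteq> 0" "\<And>i. q * y1 $ i + b \<noteq> 0"
      "\<And>i. x1 $ i * y1 $ i * (p * q - a * C) + (a + b) * (p * x1 $ i + a) \<noteq> 0"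
      "\<And>i. x1 $ i * (p * q + b * C) + (a + b) * q \<noteq> 0"
  shows "w \<in> dom (act23 (R_map \<beta>2 \<beta>3) \<circ>\<^sub>m (act13 (R_map \<beta>1 \<beta>3) \<circ>\<^sub>m act12 (R_map \<beta>1 \<beta>2)))"
    and "w \<in> dom (act12 (R_map \<beta>1 \<beta>2) \<circ>\<^sub>m (act13 (R_map \<beta>1 \<beta>3) \<circ>\<^sub>m act23 (R_map \<beta>2 \<beta>3)))"
proof -
  define A where "A = (\<Sum>i\<in>UNIV. y2 $ i / x1 $ i)"
  define B where "B = (\<Sum>i\<in>UNIV. z2 $ i / y1 $ i)"
  have p: "p = 1 - A" and q: "q = 1 - B" and C: "C = (\<Sum>i\<in>UNIV. z2 $ i / (x1 $ i * y1 $ i))"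
    and ab: "\<beta>1 - \<beta>2 = a" "\<beta>2 - \<beta>3 = b" "\<beta>1 - \<beta>3 = a + b"
    by (simp_all add: p_def q_def C_def A_def B_def a_def b_def)
  define c where "c = (\<beta>1 - \<beta>2) / (1 - A)"
  define d where "d = (\<beta>1 - \<beta>3) / (1 - (B + c * C))"
  define e where "e = (\<beta>2 - \<beta>3) / (1 - (A - d * C))"
  define c' where "c' = (\<beta>2 - \<beta>3) / (1 - B)"
  define d' where "d' = (\<beta>1 - \<beta>3) / (1 - (A - c' * C))"
  define e' where "e' = (\<beta>1 - \<beta>2) / (1 - (B + d' * C))"
  have eqs: "1 - (B + c * C) = q - c * C" "1 - (A - d * C) = p + d * C"
    "1 - (A - c' * C) = p + c' * C" "1 - (B + d' * C) = q - d' * C"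
    by (simp_all add: p q)
  note ids = scalar_identities [OF pq MN c_def [folded p, unfolded ab] d_def [unfolded ab eqs]
      e_def [unfolded ab eqs] c'_def [folded q, unfolded ab] d'_def [unfolded ab eqs] e'_def [unfolded ab eqs]]
  have den: "1 - A \<noteq> 0" "1 - B \<noteq> 0" "1 - (B + c * C) \<noteq> 0" "1 - (A - d * C) \<noteq> 0"
    "1 - (A - c' * C) \<noteq> 0" "1 - (B + d' * C) \<noteq> 0"
    using pq MN by (simp_all only: eqs ids(1-4) p [symmetric] q [symmetric]) simp_all
  have c_eq: "c = a / p" "c' = b / q"
    by (simp_all add: c_def c'_def p q ab)
  have xc: "x1 $ i + c \<noteq> 0" for i
    using gen(1) [of i] pq by (simp add: c_eq field_simps)
  have yc: "y1 $ i + c' \<noteq> 0" for i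
    using gen(2) [of i] pq by (simp add: c_eq field_simps)
  have xd: "x1 $ i + d' \<noteq> 0" for i
    using gen(4) [of i] MN by (simp add: ids(6) add_divide_eq_iff)
  have t: "x1 $ i * y1 $ i + d * x1 $ i + d * c \<noteq> 0" for i
  proof -
    have "x1 $ i * y1 $ i + d * x1 $ i + d * c
      = (x1 $ i * y1 $ i * (p * q - a * C) + (a + b) * (p * x1 $ i + a)) / (p * q - a * C)"
    proof -
      have "d * c = (a + b) * a / (p * q - a * C)"
        using pq by (simp add: ids(5) c_eq)
      moreover have "d * x1 $ i = (a + b) * p * x1 $ i / (p * q - a * C)"
        by (simp add: ids(5))
      ultimately show ?thesis
        using MN by (simp add: add_divide_distrib distrib_left mult.assoc)
    qed
    then show ?thesis
      using gen(3) [of i] MN by simp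
  qed
  show "w \<in> dom (act23 (R_map \<beta>2 \<beta>3) \<circ>\<^sub>m (act13 (R_map \<beta>1 \<beta>3) \<circ>\<^sub>m act12 (R_map \<beta>1 \<beta>2)))"
    unfolding dom_def mem_Collect_eq not_None_eq w_def
      lhs_Some_iff [OF A_def B_def C c_def d_def e_def] ids(9)
    using nz den xc xd t by blast
  show "w \<in> dom (act12 (R_map \<beta>1 \<beta>2) \<circ>\<^sub>m (act13 (R_map \<beta>1 \<beta>3) \<circ>\<^sub>m act23 (R_map \<beta>2 \<beta>3)))"
    unfolding dom_def mem_Collect_eq not_None_eq w_def
      rhs_Some_iff [OF A_def B_def C c'_def d'_def e'_def]
    using nz den yc xd t [unfolded ids(8), unfolded ids(7)] by blast
qed

section \<open>Density of the common domain\<close>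

text \<open>
  The conclusion has the same shape as the hypothesis, with \<open>closure E\<close> rather than \<open>E\<close> in
  both, so the lemma can be nested: a point is moved along one curve, each
  point of that curve along another, and so on.
\<close>
lemma closure_from_cofinite:
  fixes f :: "complex \<Rightarrow> 'a::topological_space"
  assumes "finite B" "continuous_on UNIV f" "\<And>t. t \<notin> B \<Longrightarrow> f t \<in> closure E"
  shows "f s \<in> closure E"
proof -
  have "closure (- B) = UNIV"
    using assms(1) by (simp add: closure_complement empty_interior_finite)
  moreover have "f ` closure (- B) \<subseteq> closure E"
    by (rule image_closure_subset) (use assms in \<open>auto intro: continuous_on_subset\<close>)
  ultimately show ?thesis
    by blast
qed

lemma finite_roots_if_nonzero:
  fixes P :: "complex poly"
  assumes "poly P s \<noteq> 0"
  shows "finite {t. poly P t = 0}"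
  using assms by (intro poly_roots_finite) auto

lemma continuous_on_diag:
  assumes "\<And>i. continuous_on S (\<lambda>t. f t i)"
  shows "continuous_on S (\<lambda>t. diag (\<chi> i. f t i))"
proof -
  have "continuous_on S (\<lambda>t. if i = j then f t i else 0)" for i j
    using assms by (cases "i = j") auto
  then show ?thesis
    unfolding diag_def vec_lambda_beta by (intro continuous_on_vec_lambda)
qed

lemma diag_triples_obtain:
  assumes "w \<in> diag_triples"
  obtains x1 x2 y1 y2 z1 z2
  where "w = ((diag x1, diag x2), (diag y1, diag y2), (diag z1, diag z2))"
proof -
  obtain X1 X2 Y1 Y2 Z1 Z2 where w: "w = ((X1, X2), (Y1, Y2), (Z1, Z2))"
    by (metis prod.exhaust)
  with assms have "is_diag X1" "is_diag X2" "is_diag Y1" "is_diag Y2" "is_diag Z1" "is_diag Z2"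
    by (simp_all add: diag_triples_def)
  with w show thesis
    by (metis is_diag_obtain that)
qed

text \<open>
  Multiplying \<open>y2\<close> and \<open>z2\<close> by \<open>\<tau>\<close> multiplies \<open>A, B, C\<close> by \<open>\<tau>\<close>. The conditions of
  \<open>compositions_defined\<close> become polynomials in \<open>\<tau>\<close>, and the hypotheses here say that their
  constant terms are nonzero.
\<close>
lemma common_domain_scaled:
  fixes x1 x2 y1 y2 z1 z2 :: "complex ^ ('n::finite)" and \<beta>1 \<beta>2 \<beta>3 :: complex
  defines "E \<equiv> dom (act23 (R_map \<beta>2 \<beta>3) \<circ>\<^sub>m (act13 (R_map \<beta>1 \<beta>3) \<circ>\<^sub>m act12 (R_map \<beta>1 \<beta>2))) \<inter>
      dom (act12 (R_map \<beta>1 \<beta>2) \<circ>\<^sub>m (act13 (R_map \<beta>1 \<beta>3) \<circ>\<^sub>m act23 (R_map \<beta>2 \<beta>3)))"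
  assumes nz: "\<And>i. x1 $ i \<noteq> 0" "\<And>i. y1 $ i \<noteq> 0"
    and gen: "\<And>i. x1 $ i + (\<beta>1 - \<beta>2) \<noteq> 0" "\<And>i. x1 $ i + (\<beta>1 - \<beta>3) \<noteq> 0"
      "\<And>i. y1 $ i + (\<beta>2 - \<beta>3) \<noteq> 0"
      "\<And>i. x1 $ i * y1 $ i + (\<beta>1 - \<beta>3) * (x1 $ i + (\<beta>1 - \<beta>2)) \<noteq> 0"
  obtains T where "finite T" "\<And>\<tau>. \<tau> \<notin> T \<Longrightarrow>
    ((diag x1, diag x2), (diag y1, diag (\<chi> i. \<tau> * y2 $ i)), (diag z1, diag (\<chi> i. \<tau> * z2 $ i))) \<in> E"
proof -
  define a where "a = \<beta>1 - \<beta>2"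
  define b where "b = \<beta>2 - \<beta>3"
  have ab: "\<beta>1 - \<beta>3 = a + b"
    by (simp add: a_def b_def)
  note gen' = gen [folded a_def b_def, unfolded ab]
  define A where "A = (\<Sum>i\<in>UNIV. y2 $ i / x1 $ i)"
  define B where "B = (\<Sum>i\<in>UNIV. z2 $ i / y1 $ i)"
  define C where "C = (\<Sum>i\<in>UNIV. z2 $ i / (x1 $ i * y1 $ i))"
  define p where "p = [:1, - A:]"
  define q where "q = [:1, - B:]"
  define M where "M = p * q - [:0, a * C:]"
  define N where "N = p * q + [:0, b * C:]"
  define F :: "'n \<Rightarrow> complex poly set" where "F = (\<lambda>i. {p, q, M, N, [:x1 $ i:] * p + [:a:], [:y1 $ i:] * q + [:b:],
     [:x1 $ i * y1 $ i:] * M + [:a + b:] * ([:x1 $ i:] * p + [:a:]), [:x1 $ i:] * N + [:a + b:] * q})"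
  define T where "T = (\<Union>i. \<Union>P\<in>F i. {\<tau>. poly P \<tau> = 0})"
  show thesis
  proof
    have "poly P 0 \<noteq> 0" if "P \<in> F i" for P i
      using that nz [of i] gen' [of i] by (auto simp: F_def p_def q_def M_def N_def mult.commute)
    then show "finite T"
      unfolding T_def by (intro finite_UN_I finite_roots_if_nonzero [where s = 0]) (auto simp: F_def)
  next
    fix \<tau> assume "\<tau> \<notin> T"
    then have P: "poly P \<tau> \<noteq> 0" if "P \<in> F i" for P i
      using that by (auto simp: T_def)
    have sums: "(\<Sum>i\<in>UNIV. (\<chi> i. \<tau> * y2 $ i) $ i / x1 $ i) = \<tau> * A"
      "(\<Sum>i\<in>UNIV. (\<chi> i. \<tau> * z2 $ i) $ i / y1 $ i) = \<tau> * B"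
      "(\<Sum>i\<in>UNIV. (\<chi> i. \<tau> * z2 $ i) $ i / (x1 $ i * y1 $ i)) = \<tau> * C"
      by (simp_all add: A_def B_def C_def sum_distrib_left)
    have ev: "1 - \<tau> * A = poly p \<tau>" "1 - \<tau> * B = poly q \<tau>"
      by (simp_all add: p_def q_def)
    have ev2: "poly p \<tau> * poly q \<tau> - a * (\<tau> * C) = poly M \<tau>"
      "poly p \<tau> * poly q \<tau> + b * (\<tau> * C) = poly N \<tau>"
      by (simp_all add: M_def N_def)
    have "poly p \<tau> \<noteq> 0" "poly q \<tau> \<noteq> 0" "poly M \<tau> \<noteq> 0" "poly N \<tau> \<noteq> 0"
      using P by (auto simp: F_def)
    moreover have "poly p \<tau> * x1 $ i + a \<noteq> 0" "poly q \<tau> * y1 $ i + b \<noteq> 0"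
      "x1 $ i * y1 $ i * poly M \<tau> + (a + b) * (poly p \<tau> * x1 $ i + a) \<noteq> 0"
      "x1 $ i * poly N \<tau> + (a + b) * poly q \<tau> \<noteq> 0" for i
      using P [of "[:x1 $ i:] * p + [:a:]" i] P [of "[:y1 $ i:] * q + [:b:]" i]
        P [of "[:x1 $ i * y1 $ i:] * M + [:a + b:] * ([:x1 $ i:] * p + [:a:])" i]
        P [of "[:x1 $ i:] * N + [:a + b:] * q" i]
      by (simp_all add: F_def mult.commute)
    ultimately show "((diag x1, diag x2), (diag y1, diag (\<chi> i. \<tau> * y2 $ i)), (diag z1, diag (\<chi> i. \<tau> * z2 $ i))) \<in> E"
      unfolding E_def
      by (intro IntI compositions_defined nz; unfold sums ev a_def [symmetric] b_def [symmetric] ev2)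
  qed
qed

lemma common_domain_dense:
  fixes \<beta>1 \<beta>2 \<beta>3 :: complex
  defines "E \<equiv> dom (act23 (R_map \<beta>2 \<beta>3) \<circ>\<^sub>m (act13 (R_map \<beta>1 \<beta>3) \<circ>\<^sub>m act12 (R_map \<beta>1 \<beta>2))) \<inter>
      dom (act12 (R_map \<beta>1 \<beta>2) \<circ>\<^sub>m (act13 (R_map \<beta>1 \<beta>3) \<circ>\<^sub>m act23 (R_map \<beta>2 \<beta>3)))"
  shows "diag_triples \<subseteq> closure ((diag_triples ::
         (('n cmat \<times> 'n cmat) \<times> ('n cmat \<times> 'n cmat) \<times> (('n::finite) cmat \<times> 'n cmat)) set) \<inter> E)"
proof
  fix w :: "('n cmat \<times> 'n cmat) \<times> ('n cmat \<times> 'n cmat) \<times> ('n cmat \<times> 'n cmat)"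
  assume "w \<in> diag_triples"
  then obtain x1 x2 y1 y2 z1 z2
    where w: "w = ((diag x1, diag x2), (diag y1, diag y2), (diag z1, diag z2))"
    by (rule diag_triples_obtain)
  define \<Phi> where "\<Phi> s t \<tau> = ((diag (\<chi> i. x1 $ i + s), diag x2), (diag (\<chi> i. y1 $ i + t),
     diag (\<chi> i. \<tau> * y2 $ i)), (diag z1, diag (\<chi> i. \<tau> * z2 $ i)))" for s t \<tau>
  have cont: "continuous_on UNIV (\<lambda>s. \<Phi> s t \<tau>)" "continuous_on UNIV (\<lambda>t. \<Phi> s t \<tau>)"
    "continuous_on UNIV (\<lambda>\<tau>. \<Phi> s t \<tau>)" for s t \<tau>
    unfolding \<Phi>_def
    by (intro continuous_on_Pair continuous_on_diag continuous_on_const continuous_on_add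
        continuous_on_mult continuous_on_id)+
  have shift: "v + s + k \<noteq> 0" if "s \<noteq> - v - k" for v s k :: complex
  proof
    assume *: "v + s + k = 0"
    have "s = (v + s + k) - v - k"
      by simp
    then show False
      using that unfolding * by simp
  qed
  have "\<Phi> 0 0 1 \<in> closure (diag_triples \<inter> E)"
  proof (rule closure_from_cofinite [where f = "\<lambda>s. \<Phi> s 0 1"])
    \<comment> \<open>The subtrahend \<open>0\<close> lets \<open>shift\<close> cover all three values.\<close>
    let ?S = "\<Union>i. {- x1 $ i - 0, - x1 $ i - (\<beta>1 - \<beta>2), - x1 $ i - (\<beta>1 - \<beta>3)}"
    show "finite ?S"
      by simp
    show "continuous_on UNIV (\<lambda>s. \<Phi> s 0 1)"
      by (rule cont)
    fix s assume "s \<notin> ?S"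
    then have "x1 $ i + s + k \<noteq> 0" if "k \<in> {0, \<beta>1 - \<beta>2, \<beta>1 - \<beta>3}" for i k
      using that by (intro shift) blast
    from this [of 0] this [of "\<beta>1 - \<beta>2"] this [of "\<beta>1 - \<beta>3"]
    have s: "x1 $ i + s \<noteq> 0" "x1 $ i + s + (\<beta>1 - \<beta>2) \<noteq> 0" "x1 $ i + s + (\<beta>1 - \<beta>3) \<noteq> 0" for i
      by simp_all
    show "\<Phi> s 0 1 \<in> closure (diag_triples \<inter> E)"
    proof (rule closure_from_cofinite [where f = "\<lambda>t. \<Phi> s t 1"])
      \<comment> \<open>The last of the three values of \<open>t\<close> solves the remaining condition of
        \<open>common_domain_scaled\<close>, which is linear in \<open>t\<close> with leading coefficient \<open>x1 $ i + s\<close>.\<close>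
      let ?T = "\<Union>i. {- y1 $ i - 0, - y1 $ i - (\<beta>2 - \<beta>3),
          - y1 $ i - (\<beta>1 - \<beta>3) * (x1 $ i + s + (\<beta>1 - \<beta>2)) / (x1 $ i + s)}"
      show "finite ?T"
        by simp
      show "continuous_on UNIV (\<lambda>t. \<Phi> s t 1)"
        by (rule cont)
      fix t assume T: "t \<notin> ?T"
      then have "y1 $ i + t + k \<noteq> 0" if "k \<in> {0, \<beta>2 - \<beta>3}" for i k
        using that by (intro shift) blast
      from this [of 0] this [of "\<beta>2 - \<beta>3"]
      have t: "y1 $ i + t \<noteq> 0" "y1 $ i + t + (\<beta>2 - \<beta>3) \<noteq> 0" for i
        by simp_all
      have t': "(x1 $ i + s) * (y1 $ i + t) + (\<beta>1 - \<beta>3) * (x1 $ i + s + (\<beta>1 - \<beta>2)) \<noteq> 0" for i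
      proof
        assume *: "(x1 $ i + s) * (y1 $ i + t) + (\<beta>1 - \<beta>3) * (x1 $ i + s + (\<beta>1 - \<beta>2)) = 0"
        have "t = - y1 $ i + ((x1 $ i + s) * (y1 $ i + t)) / (x1 $ i + s)"
          using s(1) [of i] by simp
        also have "\<dots> = - y1 $ i - (\<beta>1 - \<beta>3) * (x1 $ i + s + (\<beta>1 - \<beta>2)) / (x1 $ i + s)"
          unfolding eq_neg_iff_add_eq_0 [THEN iffD2, OF *] by simp
        finally show False
          using T by blast
      qed
      obtain T where T: "finite T" "\<And>\<tau>. \<tau> \<notin> T \<Longrightarrow> \<Phi> s t \<tau> \<in> E"
      proof (rule common_domain_scaled [of "\<chi> i. x1 $ i + s" "\<chi> i. y1 $ i + t" \<beta>1 \<beta>2 \<beta>3 x2 y2 z1 z2,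
            folded \<Phi>_def E_def])
      qed (simp_all only: vec_lambda_beta s t t' not_False_eq_True)
      show "\<Phi> s t 1 \<in> closure (diag_triples \<inter> E)"
      proof (rule closure_from_cofinite [where f = "\<Phi> s t"])
        show "finite T" by fact
        show "continuous_on UNIV (\<Phi> s t)"
          by (rule cont)
        fix \<tau> assume "\<tau> \<notin> T"
        then have "\<Phi> s t \<tau> \<in> diag_triples \<inter> E"
          using T(2) by (simp add: \<Phi>_def diag_triples_def)
        then show "\<Phi> s t \<tau> \<in> closure (diag_triples \<inter> E)"
          by (rule subsetD [OF closure_subset])
      qed
    qed
  qed
  then show "w \<in> closure (diag_triples \<inter> E)"
    by (simp add: \<Phi>_def w)
qed

lemma yang_baxter:
  "rat_eq_on (diag_triples ::
         (('n cmat \<times> 'n cmat) \<times> ('n cmat \<times> 'n cmat) \<times> (('n::finite) cmat \<times> 'n cmat)) set)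
       (act23 (R_map \<beta>2 \<beta>3) \<circ>\<^sub>m (act13 (R_map \<beta>1 \<beta>3) \<circ>\<^sub>m act12 (R_map \<beta>1 \<beta>2)))
       (act12 (R_map \<beta>1 \<beta>2) \<circ>\<^sub>m (act13 (R_map \<beta>1 \<beta>3) \<circ>\<^sub>m act23 (R_map \<beta>2 \<beta>3)))"
  (is "rat_eq_on ?D ?f ?g")
  unfolding rat_eq_on_def Int_assoc
proof (intro conjI ballI)
  show "?D \<subseteq> closure (?D \<inter> (dom ?f \<inter> dom ?g))"
    by (rule common_domain_dense)
next
  fix w assume w: "w \<in> ?D \<inter> (dom ?f \<inter> dom ?g)"
  then obtain x1 x2 y1 y2 z1 z2
    where coords: "w = ((diag x1, diag x2), (diag y1, diag y2), (diag z1, diag z2))"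
    by (blast elim: diag_triples_obtain)
  from w obtain v v' where v: "?f w = Some v" "?g w = Some v'"
    by blast
  then have "v = v'"
    unfolding coords by (rule compositions_agree)
  then show "?f w = ?g w"
    by (simp only: v)
qed

theorem mainTheorem11:
  fixes \<beta>1 \<beta>2 \<beta>3 :: complex
  shows
    "(\<forall>u v u1 u2 v2 u12 v12 :: complex ^ ('n::finite).
        invertible (diag u) \<and> invertible (diag u1) \<and> invertible (diag u12) \<and>
        1 - bdot u1 v2 \<noteq> 0 \<and>
        u12 = u + ((\<beta>1 - \<beta>2) / (1 - bdot u1 v2)) *s u1 \<and>
        v12 = v + ((\<beta>2 - \<beta>1) / (1 - bdot u1 v2)) *s v2 \<longrightarrow>
        R_map \<beta>1 \<beta>2
          ((diag u ** matrix_inv (diag u1), diag v ** diag u1),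
           (diag u2 ** matrix_inv (diag u), diag u ** diag v2))
        = Some
          ((diag u2 ** matrix_inv (diag u12), diag v2 ** diag u12),
           (diag u12 ** matrix_inv (diag u1), diag u1 ** diag v12)))
     \<and>
     rat_eq_on (diag_triples ::
         (('n cmat \<times> 'n cmat) \<times> ('n cmat \<times> 'n cmat) \<times> ('n cmat \<times> 'n cmat)) set)
       (act23 (R_map \<beta>2 \<beta>3) \<circ>\<^sub>m (act13 (R_map \<beta>1 \<beta>3) \<circ>\<^sub>m act12 (R_map \<beta>1 \<beta>2)))
       (act12 (R_map \<beta>1 \<beta>2) \<circ>\<^sub>m (act13 (R_map \<beta>1 \<beta>3) \<circ>\<^sub>m act23 (R_map \<beta>2 \<beta>3)))"
proof (intro conjI allI impI)
  fix u v u1 u2 v2 u12 v12 :: "complex ^ 'n"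
  assume "invertible (diag u) \<and> invertible (diag u1) \<and> invertible (diag u12) \<and>
        1 - bdot u1 v2 \<noteq> 0 \<and>
        u12 = u + ((\<beta>1 - \<beta>2) / (1 - bdot u1 v2)) *s u1 \<and>
        v12 = v + ((\<beta>2 - \<beta>1) / (1 - bdot u1 v2)) *s v2"
  then show "R_map \<beta>1 \<beta>2
          ((diag u ** matrix_inv (diag u1), diag v ** diag u1),
           (diag u2 ** matrix_inv (diag u), diag u ** diag v2))
        = Some
          ((diag u2 ** matrix_inv (diag u12), diag v2 ** diag u12),
           (diag u12 ** matrix_inv (diag u1), diag u1 ** diag v12))"
    by (intro R_map_lattice) auto
qed (rule yang_baxter)

end
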